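(* Let $L$ and $J$ be $2n\times2n$ complex matrices with $L$ Hermitian and $J$ invertible and skew-Hermitian, and let $\mathcal L(\lambda):=L-\lambda K$ with $K:=(iJ)^{-1}$. Let $2n_{\mathrm u}$ be the total algebraic multiplicity of all eigenvalues $\nu$ of $JL$ with $\operatorname{Re}\nu\neq0$. Then \[ n_{\mathrm u}=N_-(L)-\zeta-\sum_{\lambda\in\sigma(\mathcal L),\,\lambda>0}\kappa^+(\lambda)-\sum_{\lambda\in\sigma(\mathcal L),\,\lambda<0}\kappa^-(\lambda), \] where \[ \zeta=\tfrac12\dim(\operatorname{gKer}(JL))-\tfrac12\bigl(Z^\downarrow_+(\mathcal L)+Z^\downarrow_-(\mathcal L)\bigr), \] or equivalently \[ \zeta=\tfrac12\bigl(\dim(\operatorname{gKer}(JL))-2\dim(\ker L)\bigr)+\tfrac12\bigl(Z^\uparrow_+(\mathcal L)+Z^\uparrow_-(\mathcal L)\bigr). \]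
   Context: $\operatorname{gKer}(JL)$ is the generalized kernel of $JL$ (the algebraic eigenspace for eigenvalue $0$). $N_-(L)$ is the number of negative eigenvalues of $L$ with multiplicity. Characteristic values of $\mathcal L$ are the $\lambda$ with $\det\mathcal L(\lambda)=0$; $\sigma(\mathcal L)$ is their set, and the sums run over real characteristic values (which correspond to the purely imaginary eigenvalues $\nu=-i\lambda$ of $JL$). For real $\lambda$ the eigenvalues of the Hermitian matrix $\mathcal L(\lambda)$ can be chosen as $2n$ real analytic branches $\mu(\lambda)$. $Z^\downarrow_\pm(\mathcal L)$ (resp. $Z^\uparrow_\pm(\mathcal L)$) is the number of branches with $\mu(0)=0$ and $\mu(\lambda)<0$ (resp. $\mu(\lambda)>0$) for all sufficiently small $\pm\lambda>0$. Graphical Krein indices: for a real characteristic value $\lambda_0$ and a branch $\mu$ with $\mu^{(n)}(\lambda_0)=0$ for $n<m$, $\mu^{(m)}(\lambda_0)\ne0$, $\eta=\operatorname{sign}\mu^{(m)}(\lambda_0)$, set $\kappa^\pm(\mu,\lambda_0)=m/2$ if $m$ even and $(m\pm\eta)/2$ if $m$ odd; $\kappa^\pm(\lambda_0)$ is the sum over all branches vanishing at $\lambda_0$. *)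

theory Defs
  imports "HOL-Analysis.Analysis" "Jordan_Normal_Form.Jordan_Normal_Form"
          "Jordan_Normal_Form.Schur_Decomposition" "Jordan_Normal_Form.Matrix_Kernel"
begin

definition hermitian_mat :: "complex mat \<Rightarrow> bool" where
  "hermitian_mat A \<longleftrightarrow> mat_adjoint A = A"

definition skew_hermitian_mat :: "complex mat \<Rightarrow> bool" where
  "skew_hermitian_mat A \<longleftrightarrow> mat_adjoint A = - A"

definition alg_mult :: "complex mat \<Rightarrow> complex \<Rightarrow> nat" where
  "alg_mult A a = Polynomial.order a (char_poly A)"

definition alg_mult_in :: "complex mat \<Rightarrow> complex set \<Rightarrow> nat" where
  "alg_mult_in A S = (\<Sum>a\<in>{a. poly (char_poly A) a = 0 \<and> a \<in> S}. alg_mult A a)"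

definition neg_count :: "complex mat \<Rightarrow> nat" where
  "neg_count L = alg_mult_in L {a. a \<in> \<real> \<and> Re a < 0}"

text \<open>dim gKer(A): dimension of the generalized kernel = algebraic multiplicity of 0.\<close>
definition gker_dim :: "complex mat \<Rightarrow> nat" where
  "gker_dim A = alg_mult A 0"

definition pencil :: "complex mat \<Rightarrow> complex mat \<Rightarrow> complex \<Rightarrow> complex mat" where
  "pencil L K t = L - t \<cdot>\<^sub>m K"

definition real_analytic :: "(real \<Rightarrow> real) \<Rightarrow> bool" where
  "real_analytic f \<longleftrightarrow> (\<forall>x. \<exists>r>0. \<exists>a::nat \<Rightarrow> real.
      \<forall>y. \<bar>y - x\<bar> < r \<longrightarrow> (\<lambda>k. a k * (y - x) ^ k) sums f y)"

definition eigen_branches :: "complex mat \<Rightarrow> complex mat \<Rightarrow> nat \<Rightarrow> (nat \<Rightarrow> real \<Rightarrow> real) \<Rightarrow> bool" where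
  "eigen_branches L K N \<mu> \<longleftrightarrow> (\<forall>j<N. real_analytic (\<mu> j)) \<and>
     (\<forall>t::real. char_poly (pencil L K (complex_of_real t))
                 = (\<Prod>j<N. [: - complex_of_real (\<mu> j t), 1 :]))"

definition vanish_order :: "(real \<Rightarrow> real) \<Rightarrow> real \<Rightarrow> nat" where
  "vanish_order f x0 = (LEAST m. (deriv ^^ m) f x0 \<noteq> 0)"

text \<open>Graphical Krein index kappa^{+} (s = 1) resp. kappa^{-} (s = -1) of a branch at x0.\<close>
definition krein_branch :: "real \<Rightarrow> (real \<Rightarrow> real) \<Rightarrow> real \<Rightarrow> real" where
  "krein_branch s f x0 =
     (let m = vanish_order f x0; \<eta> = sgn ((deriv ^^ m) f x0) in
      if even m then real m / 2 else (real m + s * \<eta>) / 2)"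

definition krein_index :: "real \<Rightarrow> nat \<Rightarrow> (nat \<Rightarrow> real \<Rightarrow> real) \<Rightarrow> real \<Rightarrow> real" where
  "krein_index s N \<mu> x0 = (\<Sum>j\<in>{j. j < N \<and> \<mu> j x0 = 0}. krein_branch s (\<mu> j) x0)"

definition real_char_values :: "complex mat \<Rightarrow> complex mat \<Rightarrow> real set" where
  "real_char_values L K = {t::real. det (pencil L K (complex_of_real t)) = 0}"

definition Z_down_plus :: "nat \<Rightarrow> (nat \<Rightarrow> real \<Rightarrow> real) \<Rightarrow> nat" where
  "Z_down_plus N \<mu> = card {j. j < N \<and> \<mu> j 0 = 0 \<and> (\<forall>\<^sub>F t in at_right 0. \<mu> j t < 0)}"
definition Z_down_minus :: "nat \<Rightarrow> (nat \<Rightarrow> real \<Rightarrow> real) \<Rightarrow> nat" where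
  "Z_down_minus N \<mu> = card {j. j < N \<and> \<mu> j 0 = 0 \<and> (\<forall>\<^sub>F t in at_left 0. \<mu> j t < 0)}"
definition Z_up_plus :: "nat \<Rightarrow> (nat \<Rightarrow> real \<Rightarrow> real) \<Rightarrow> nat" where
  "Z_up_plus N \<mu> = card {j. j < N \<and> \<mu> j 0 = 0 \<and> (\<forall>\<^sub>F t in at_right 0. \<mu> j t > 0)}"
definition Z_up_minus :: "nat \<Rightarrow> (nat \<Rightarrow> real \<Rightarrow> real) \<Rightarrow> nat" where
  "Z_up_minus N \<mu> = card {j. j < N \<and> \<mu> j 0 = 0 \<and> (\<forall>\<^sub>F t in at_left 0. \<mu> j t > 0)}"

end

theory Submission
  imports Defs "Jordan_Normal_Form.Jordan_Normal_Form_Existence"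
    "Jordan_Normal_Form.Jordan_Normal_Form_Uniqueness"
begin

text \<open>
  On the real axis \<open>det (L - t K)\<close> is the product of the branches \<open>\<mu> j t\<close>, and up to a nonzero
  constant it is the characteristic polynomial of \<open>J L\<close> at \<open>- \<i> t\<close>. Comparing orders of vanishing,
  the multiplicity of \<open>- \<i> x\<close> is the sum \<open>\<kappa>\<^sup>+(x) + \<kappa>\<^sup>-(x)\<close> of the vanishing orders of the branches at \<open>x\<close>;
  adding up all eigenvalues of \<open>J L\<close> gives one linear relation. The second relation counts negative
  branches: at \<open>x\<close> their number drops by \<open>\<kappa>\<^sup>+(x) - \<kappa>\<^sup>-(x)\<close>, while \<open>\<mu> j t / t\<close> accumulates as
  \<open>t \<longlongrightarrow> \<plusminus>\<infinity>\<close> at the eigenvalues of the invertible matrix \<open>- K\<close>, so that the branches which are negative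
  at one end are matched by those which are positive at the other. Eliminating between the two
  relations gives the formula. The second expression for \<open>\<zeta>\<close> holds because each branch vanishing at 0
  moves up or down on either side, and there are \<open>dim (ker L)\<close> of them.
\<close>

section \<open>Local expansions and vanishing orders of real analytic functions\<close>

text \<open>Termwise differentiation keeps the radius \<open>r\<close>, so \<open>deriv f\<close>
  satisfies the same hypothesis with coefficients \<open>diffs a\<close>; hence the induction
  generalises over \<open>f\<close> and \<open>a\<close>. This turns the iterated
  \<open>deriv\<close> in \<open>vanish_order\<close> into Taylor coefficients.\<close>

lemma funpow_deriv_power_series:
  fixes f :: "real \<Rightarrow> real"
  assumes "r > 0" "\<And>y. \<bar>y - x\<bar> < r \<Longrightarrow> (\<lambda>k. a k * (y - x) ^ k) sums f y"
  shows "(deriv ^^ n) f x = fact n * a n"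
  using assms(2)
proof (induction n arbitrary: a f)
  case 0
  from 0[of x] have "(\<lambda>k. a k * 0 ^ k) sums f x" using \<open>r > 0\<close> by simp
  then show ?case using powser_sums_zero_iff by fastforce
next
  case (Suc n)
  have s: "(\<lambda>k. diffs a k * (y - x) ^ k) sums deriv f y" if y: "\<bar>y - x\<bar> < r" for y
  proof -
    let ?g = "\<lambda>z. \<Sum>k. a k * z ^ k"
    have sm: "summable (\<lambda>k. a k * z ^ k)" if "norm z < r" for z
      using Suc.prems[of "x + z"] that by (auto simp: sums_iff)
    have d: "(?g has_field_derivative (\<Sum>k. diffs a k * (y - x) ^ k)) (at (y - x))"
      by (rule termdiffs_strong'[of r]) (use sm y in auto)
    have "((\<lambda>w. ?g (w - x)) has_field_derivative (\<Sum>k. diffs a k * (y - x) ^ k)) (at y)"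
      using DERIV_shift[of ?g _ y "- x"] d by simp
    moreover have "\<forall>\<^sub>F w in nhds y. ?g (w - x) = f w"
    proof -
      have "\<forall>\<^sub>F w in nhds y. w \<in> ball x r"
        by (rule eventually_nhds_in_open) (use y in \<open>auto simp: dist_real_def\<close>)
      then show ?thesis
        by eventually_elim (use Suc.prems in \<open>auto simp: sums_iff dist_real_def\<close>)
    qed
    ultimately have "(f has_field_derivative (\<Sum>k. diffs a k * (y - x) ^ k)) (at y)"
      using DERIV_cong_ev[OF refl _ refl] by force
    then have "deriv f y = (\<Sum>k. diffs a k * (y - x) ^ k)" by (rule DERIV_imp_deriv)
    moreover have "summable (\<lambda>k. diffs a k * (y - x) ^ k)"
      by (rule termdiff_converges[of _ r]) (use sm y in auto)
    ultimately show ?thesis by (simp add: sums_iff)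
  qed
  have "(deriv ^^ Suc n) f x = (deriv ^^ n) (deriv f) x"
    by (simp add: funpow_swap1)
  also have "\<dots> = fact n * diffs a n" by (rule Suc.IH[OF s])
  finally show ?case by (simp add: diffs_def)
qed

lemma real_analytic_continuous:
  assumes "real_analytic f"
  shows "isCont f x"
proof -
  from assms obtain r a where r: "r > 0"
    and s: "\<And>y. \<bar>y - x\<bar> < r \<Longrightarrow> (\<lambda>k. a k * (y - x) ^ k) sums f y"
    unfolding real_analytic_def by blast
  have "((\<lambda>z. f (x + z)) \<longlongrightarrow> a 0) (at 0)"
    by (rule powser_limit_0[OF r]) (use s[of "x + _"] in auto)
  moreover have "f x = a 0"
    using funpow_deriv_power_series[OF r s, of 0] by simp
  ultimately show ?thesis by (simp add: isCont_iff)
qed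

text \<open>By \<open>nz\<close> some Taylor coefficient is nonzero, so the \<open>LEAST\<close> in
  \<open>vanish_order\<close> is attained. Dividing the series by its lowest power leaves a power
  series with constant term \<open>a m\<close>.\<close>

lemma vanish_order_limit:
  assumes "real_analytic f" and nz: "\<exists>\<^sub>F y in at x. f y \<noteq> 0"
  defines "m \<equiv> vanish_order f x"
  defines "c \<equiv> (deriv ^^ m) f x"
  shows "c \<noteq> 0" and "((\<lambda>y. f y / (y - x) ^ m) \<longlongrightarrow> c / fact m) (at x)"
proof -
  from assms(1) obtain r a where r: "r > 0"
    and s: "\<And>y. \<bar>y - x\<bar> < r \<Longrightarrow> (\<lambda>k. a k * (y - x) ^ k) sums f y"
    unfolding real_analytic_def by blast
  note d = funpow_deriv_power_series[OF r s]
  have "\<exists>n. a n \<noteq> 0"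
  proof (rule ccontr)
    assume "\<not> ?thesis"
    then have "f y = 0" if "\<bar>y - x\<bar> < r" for y
      using s[OF that] sums_unique2[OF sums_zero] by auto
    then have "\<forall>\<^sub>F y in at x. f y = 0"
      unfolding eventually_at using r by (auto simp: dist_real_def)
    with nz show False by (simp add: frequently_def)
  qed
  then have ex: "\<exists>n. (deriv ^^ n) f x \<noteq> 0" using d by auto
  show "c \<noteq> 0" unfolding c_def m_def vanish_order_def by (rule LeastI_ex[OF ex])
  have below: "a k = 0" if "k < m" for k
    using not_less_Least[of k "\<lambda>n. (deriv ^^ n) f x \<noteq> 0"] that d
    unfolding m_def vanish_order_def by auto
  have "(\<lambda>k. a (k + m) * z ^ k) sums (f (x + z) / z ^ m)" if z: "z \<noteq> 0" "norm z < r" for z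
  proof -
    have "(\<lambda>k. a k * z ^ k) sums f (x + z)" using s[of "x + z"] z by simp
    then have "(\<lambda>k. a (k + m) * z ^ (k + m)) sums f (x + z)"
      by (subst sums_zero_iff_shift) (use below in auto)
    then have "(\<lambda>k. a (k + m) * z ^ (k + m) / z ^ m) sums (f (x + z) / z ^ m)"
      by (rule sums_divide)
    then show ?thesis using z by (simp add: power_add)
  qed
  then have "((\<lambda>z. f (x + z) / z ^ m) \<longlongrightarrow> a (0 + m)) (at 0)"
    by (rule powser_limit_0_strong[OF r])
  then have "((\<lambda>y. f y / (y - x) ^ m) \<longlongrightarrow> a m) (at x)"
    by (subst LIM_offset_zero_iff) auto
  then show "((\<lambda>y. f y / (y - x) ^ m) \<longlongrightarrow> c / fact m) (at x)"
    using d[of m] by (simp add: c_def)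
qed

lemma vanish_order_eq_0: "f x \<noteq> 0 \<Longrightarrow> vanish_order f x = 0"
  unfolding vanish_order_def by (rule Least_equality) auto

lemma eventually_sgn_eq_of_limit:
  fixes f :: "'a \<Rightarrow> real"
  assumes "(f \<longlongrightarrow> l) F" "l \<noteq> 0"
  shows "\<forall>\<^sub>F y in F. sgn (f y) = sgn l"
proof (cases "l > 0")
  case True
  have "\<forall>\<^sub>F y in F. f y > 0" by (rule order_tendstoD(1)[OF assms(1) True])
  then show ?thesis by eventually_elim (use True in simp)
next
  case False
  then have l: "l < 0" using assms by auto
  have "\<forall>\<^sub>F y in F. f y < 0" by (rule order_tendstoD(2)[OF assms(1) l])
  then show ?thesis by eventually_elim (use l in simp)
qed

lemma sgn_power: "sgn (x ^ n) = sgn x ^ n" for x :: real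
  by (induction n) (simp_all add: sgn_mult)

lemma eventually_at_left_gt: "a < x \<Longrightarrow> \<forall>\<^sub>F y in at_left x. a < y" for x :: real
  by (rule eventually_mono[OF eventually_at_left_real]) auto

text \<open>Near \<open>x\<close> the function behaves like \<open>c / fact m * (y - x) ^ m\<close>,
  and only the power of \<open>y - x\<close> distinguishes the two sides.\<close>

lemma sgn_at_side:
  assumes "real_analytic f" "\<exists>\<^sub>F y in at x. f y \<noteq> 0"
  defines "m \<equiv> vanish_order f x"
  defines "c \<equiv> (deriv ^^ m) f x"
  shows "\<forall>\<^sub>F y in at_right x. sgn (f y) = sgn c"
    and "\<forall>\<^sub>F y in at_left x. sgn (f y) = (-1) ^ m * sgn c"
proof -
  note l = vanish_order_limit[OF assms(1,2), folded m_def, folded c_def]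
  have "\<forall>\<^sub>F y in at x. sgn (f y / (y - x) ^ m) = sgn (c / fact m)"
    by (rule eventually_sgn_eq_of_limit) (use l in auto)
  then have e: "\<forall>\<^sub>F y in at x. sgn (f y) = sgn ((y - x) ^ m) * sgn c"
    using eventually_neq_at_within[of x]
  proof eventually_elim
    case (elim y)
    have "f y = f y / (y - x) ^ m * (y - x) ^ m" using elim by simp
    then have "sgn (f y) = sgn (f y / (y - x) ^ m) * sgn ((y - x) ^ m)"
      by (metis sgn_mult)
    also have "\<dots> = sgn ((y - x) ^ m) * sgn c"
      unfolding elim(1) by (simp add: sgn_divide)
    finally show ?case .
  qed
  have "\<forall>\<^sub>F y in at_right x. sgn (f y) = sgn ((y - x) ^ m) * sgn c"
    using e unfolding eventually_at_split by blast
  then show "\<forall>\<^sub>F y in at_right x. sgn (f y) = sgn c"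
    using eventually_at_right_less[of x] by eventually_elim (simp add: sgn_power)
  have "\<forall>\<^sub>F y in at_left x. sgn (f y) = sgn ((y - x) ^ m) * sgn c"
    using e unfolding eventually_at_split by blast
  then show "\<forall>\<^sub>F y in at_left x. sgn (f y) = (-1) ^ m * sgn c"
    using eventually_at_left_real[of "x - 1" x, simplified]
    by eventually_elim (auto simp: sgn_power)
qed

section \<open>One-sided signs, Krein indices and sign changes over an interval\<close>

text \<open>For a real analytic \<open>f\<close> that is not locally zero,
  \<open>sgn_at_side\<close> shows that this is the sign of \<open>f\<close> immediately to the
  right of \<open>x\<close>. The derivative form is the one that occurs in
  \<open>krein_branch\<close>.\<close>

definition sgn_right :: "(real \<Rightarrow> real) \<Rightarrow> real \<Rightarrow> real" where
  "sgn_right f x = sgn ((deriv ^^ vanish_order f x) f x)"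

definition sgn_left :: "(real \<Rightarrow> real) \<Rightarrow> real \<Rightarrow> real" where
  "sgn_left f x = (-1) ^ vanish_order f x * sgn_right f x"

lemma krein_branch_add: "krein_branch 1 f x + krein_branch (-1) f x = real (vanish_order f x)"
  by (simp add: krein_branch_def Let_def field_simps)

text \<open>For even order both sides are 0. For odd order the indices differ by \<eta>, while the
  sign of the branch passes from -\<eta> to \<eta>. So the sum of the two indices measures
  multiplicity and their difference measures sign change.\<close>

lemma krein_branch_diff:
  "2 * (krein_branch 1 f x - krein_branch (-1) f x) = sgn_right f x - sgn_left f x"
  by (auto simp: krein_branch_def Let_def field_simps sgn_left_def sgn_right_def)

text \<open>A branch that does not vanish at \<open>x\<close> has order 0, hence index 0, so the sum
  may run over all branches.\<close>

lemma krein_index_eq_sum: "krein_index s N \<mu> x = (\<Sum>j<N. krein_branch s (\<mu> j) x)"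
  unfolding krein_index_def
  by (rule sum.mono_neutral_left) (auto simp: krein_branch_def vanish_order_eq_0)

lemma sgn_eq_if_no_zero:
  fixes f :: "real \<Rightarrow> real"
  assumes "\<And>x. isCont f x" "a \<le> b" "\<And>y. y \<in> {a..b} \<Longrightarrow> f y \<noteq> 0"
  shows "sgn (f a) = sgn (f b)"
proof (rule ccontr)
  assume "sgn (f a) \<noteq> sgn (f b)"
  then have "f a \<le> 0 \<and> 0 \<le> f b \<or> f b \<le> 0 \<and> 0 \<le> f a"
    by (auto simp: sgn_if split: if_splits)
  then obtain z where "a \<le> z" "z \<le> b" "f z = 0"
    using IVT[of f a 0 b] IVT2[of f b 0 a] assms(1,2) by blast
  with assms(3) show False by auto
qed

text \<open>Telescoping: by the intermediate value theorem the sign is constant between consecutive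
  points of \<open>X\<close>. The set \<open>X\<close> may contain points where \<open>f\<close>
  does not vanish, so a common \<open>X\<close> can serve several branches.\<close>

lemma sgn_change_eq_sum_jumps:
  fixes f jr jl :: "real \<Rightarrow> real"
  assumes cont: "\<And>x. isCont f x"
    and right: "\<And>x. \<forall>\<^sub>F y in at_right x. sgn (f y) = jr x"
    and left: "\<And>x. \<forall>\<^sub>F y in at_left x. sgn (f y) = jl x"
    and "finite X" "X \<subseteq> {a<..<b}" "a \<le> b" "\<And>y. y \<in> {a..b} - X \<Longrightarrow> f y \<noteq> 0"
  shows "sgn (f b) - sgn (f a) = (\<Sum>x\<in>X. jr x - jl x)"
  using assms(4-)
proof (induction X arbitrary: b rule: finite_linorder_max_induct)
  case empty
  then show ?case using sgn_eq_if_no_zero[OF cont, of a b] by auto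
next
  case (insert x X)
  have x: "a < x" "x < b" using insert.prems by auto
  \<comment> \<open>Here \<open>x\<close> is the largest point. The point \<open>c\<close> is taken
    between the earlier points and \<open>x\<close>, so that the induction hypothesis applies on
    \<open>{a..c}\<close>; \<open>d\<close> is taken just beyond \<open>x\<close>.\<close>
  have "\<forall>\<^sub>F y in at_left x. a < y \<and> (\<forall>z\<in>X. z < y)"
    using insert.hyps x by (auto simp: eventually_conj_iff eventually_ball_finite_distrib
        intro!: eventually_at_left_gt)
  from eventually_happens[OF eventually_conj[OF this
        eventually_conj[OF left eventually_at_left_real[OF x(1)]]]]
  obtain c where c: "a < c" "c < x" "\<forall>z\<in>X. z < c" "sgn (f c) = jl x" by auto
  from eventually_happens[OF eventually_conj[OF right eventually_at_right_real[OF x(2)]]]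
  obtain d where d: "x < d" "d < b" "sgn (f d) = jr x" by auto
  have "sgn (f c) - sgn (f a) = (\<Sum>x\<in>X. jr x - jl x)"
    by (rule insert.IH) (use insert.prems c x in auto)
  moreover have "sgn (f d) = sgn (f b)"
  proof (rule sgn_eq_if_no_zero[OF cont])
    show "f y \<noteq> 0" if "y \<in> {d..b}" for y
    proof (rule insert.prems)
      show "y \<in> {a..b} - insert x X" using that x(1) d(1) insert.hyps(2) by fastforce
    qed
  qed (use d in simp)
  moreover have "x \<notin> X" using insert.hyps by auto
  ultimately show ?case using c d insert.hyps by simp
qed

section \<open>Multiplicities of split polynomials as index counts\<close>

lemma prod_linear_neq_0: "(\<Prod>j\<in>J. [:- c j, 1:]) \<noteq> (0 :: 'a :: idom poly)"
  by (cases "finite J") auto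

lemma order_prod_linear:
  fixes c :: "nat \<Rightarrow> 'a :: idom"
  shows "Polynomial.order x (\<Prod>j<N. [:- c j, 1:]) = card {j. j < N \<and> c j = x}"
proof (induction N)
  case 0
  then show ?case by simp
next
  case (Suc N)
  have "{j. j < Suc N \<and> c j = x} = {j. j < N \<and> c j = x} \<union> (if c N = x then {N} else {})"
    by (auto simp: less_Suc_eq)
  then have "card {j. j < Suc N \<and> c j = x} = card {j. j < N \<and> c j = x} + (if c N = x then 1 else 0)"
    by (simp add: card_insert_if)
  moreover have "(\<Prod>j<N. [:- c j, 1:]) * [:- c N, 1:] \<noteq> 0"
    by (intro no_zero_divisors prod_linear_neq_0) simp
  then have "Polynomial.order x (\<Prod>j<Suc N. [:- c j, 1:])
      = Polynomial.order x (\<Prod>j<N. [:- c j, 1:]) + Polynomial.order x [:- c N, 1:]"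
    unfolding prod.lessThan_Suc by (rule order_mult)
  ultimately show ?case
    using Suc.IH by (auto simp: order_linear')
qed

text \<open>Indices are grouped by the root they name. The right-hand side depends on
  \<open>p\<close> alone, so the sum is the same for every enumeration of the roots.\<close>

lemma sum_prod_linear_roots:
  fixes c :: "nat \<Rightarrow> 'a :: idom" and f :: "'a \<Rightarrow> 'b :: comm_semiring_1"
  assumes p: "p = (\<Prod>j<N. [:- c j, 1:])"
  shows "(\<Sum>j<N. f (c j)) = (\<Sum>x | poly p x = 0. of_nat (Polynomial.order x p) * f x)"
proof -
  have roots: "{x. poly p x = 0} = c ` {..<N}"
    by (auto simp: p poly_prod)
  have "(\<Sum>j<N. f (c j)) = (\<Sum>x\<in>c ` {..<N}. \<Sum>j\<in>{j\<in>{..<N}. c j = x}. f (c j))"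
    by (rule sum.image_gen) simp
  also have "\<dots> = (\<Sum>x\<in>c ` {..<N}. of_nat (Polynomial.order x p) * f x)"
    by (rule sum.cong) (auto simp: p order_prod_linear)
  finally show ?thesis unfolding roots .
qed

lemma alg_mult_in_eq_card:
  fixes c :: "nat \<Rightarrow> complex"
  assumes "char_poly A = (\<Prod>j<N. [:- c j, 1:])"
  shows "alg_mult_in A S = card {j. j < N \<and> c j \<in> S}"
proof -
  let ?p = "char_poly A"
  have fin: "finite {x. poly ?p x = 0}"
    by (rule poly_roots_finite) (simp only: assms prod_linear_neq_0 not_False_eq_True)
  have "card {j. j < N \<and> c j \<in> S} = (\<Sum>j<N. of_bool (c j \<in> S))"
    by (subst sum_of_bool_eq) (simp_all add: Collect_conj_eq lessThan_def)
  also have "\<dots> = (\<Sum>x | poly ?p x = 0. Polynomial.order x ?p * of_bool (x \<in> S))"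
    using sum_prod_linear_roots[OF assms, of "\<lambda>x. of_bool (x \<in> S) :: nat"] by simp
  also have "\<dots> = (\<Sum>x \<in> {x. poly ?p x = 0 \<and> x \<in> S}. Polynomial.order x ?p)"
    by (rule sum.mono_neutral_cong_right) (use fin in auto)
  finally show ?thesis by (simp add: alg_mult_in_def alg_mult_def)
qed

section \<open>Orders on the imaginary axis and signs along the half-lines\<close>

lemma eventually_at_right_lt: "x < a \<Longrightarrow> \<forall>\<^sub>F y in at_right x. y < a" for x :: real
  by (rule eventually_mono[OF eventually_at_right_real]) auto

lemma eventually_at_left_less: "\<forall>\<^sub>F y in at_left x. y < x" for x :: real
  by (rule eventually_mono[OF eventually_at_left_real[of "x - 1"]]) auto

lemma eventually_notin_finite: "finite R \<Longrightarrow> \<forall>\<^sub>F y in at x. y \<notin> R"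
  for x :: "'a :: t1_space"
  using islimpt_finite[of R x] by (simp add: islimpt_iff_eventually)

text \<open>If \<open>k < m\<close>, multiplying the second quotient by
  \<open>\<bar>y - x\<bar> ^ (m - k)\<close> gives the first one, which would then tend to
  0.\<close>

lemma exponent_eq_of_limits:
  fixes f :: "real \<Rightarrow> real"
  assumes "((\<lambda>y. f y / \<bar>y - x\<bar> ^ k) \<longlongrightarrow> a) (at x)" "a \<noteq> 0"
    and "((\<lambda>y. f y / \<bar>y - x\<bar> ^ m) \<longlongrightarrow> b) (at x)" "b \<noteq> 0"
  shows "k = m"
proof -
  have *: False
    if "((\<lambda>y. f y / \<bar>y - x\<bar> ^ k) \<longlongrightarrow> a) (at x)" "a \<noteq> 0"
      "((\<lambda>y. f y / \<bar>y - x\<bar> ^ m) \<longlongrightarrow> b) (at x)" "k < m" for a b k m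
  proof -
    have "((\<lambda>y. \<bar>y - x\<bar> ^ (m - k)) \<longlongrightarrow> \<bar>x - x\<bar> ^ (m - k)) (at x)"
      by (intro tendsto_intros)
    from tendsto_mult[OF that(3) this]
    have "((\<lambda>y. f y / \<bar>y - x\<bar> ^ m * \<bar>y - x\<bar> ^ (m - k)) \<longlongrightarrow> 0) (at x)"
      using that(4) by (simp add: power_0_left)
    moreover have "\<forall>\<^sub>F y in at x. f y / \<bar>y - x\<bar> ^ m * \<bar>y - x\<bar> ^ (m - k) = f y / \<bar>y - x\<bar> ^ k"
      using eventually_neq_at_within[of x x UNIV]
      by eventually_elim (use that(4) in \<open>simp add: power_diff\<close>)
    ultimately have "((\<lambda>y. f y / \<bar>y - x\<bar> ^ k) \<longlongrightarrow> 0) (at x)"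
      by (rule Lim_transform_eventually)
    from tendsto_unique[OF _ this that(1)] that(2) show False by simp
  qed
  show ?thesis using *[OF assms(1,2,3)] *[OF assms(3,4,1)] by (meson linorder_neqE_nat)
qed

text \<open>Both numbers are the exponent of \<open>\<bar>t - x\<bar>\<close> in the modulus of
  \<open>q\<close> at \<open>- \<i> * t\<close>: one from splitting off the root of
  \<open>q\<close>, the other from the leading terms of the branches. Taking moduli removes the
  powers of \<open>- \<i>\<close>.\<close>

lemma order_eq_sum_vanish_order:
  fixes \<mu> :: "nat \<Rightarrow> real \<Rightarrow> real"
  assumes an: "\<And>j. j < N \<Longrightarrow> real_analytic (\<mu> j)"
    and nz: "\<And>j. j < N \<Longrightarrow> \<exists>\<^sub>F y in at x. \<mu> j y \<noteq> 0"
    and q: "\<And>t. poly q (- \<i> * complex_of_real t) = C * complex_of_real (\<Prod>j<N. \<mu> j t)"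
    and "q \<noteq> 0" "C \<noteq> 0"
  shows "Polynomial.order (- \<i> * complex_of_real x) q = (\<Sum>j<N. vanish_order (\<mu> j) x)"
proof -
  let ?z = "- \<i> * complex_of_real x" and ?M = "\<Sum>j<N. vanish_order (\<mu> j) x"
  let ?f = "\<lambda>t. cmod (poly q (- \<i> * complex_of_real t))"
  obtain q2 where q2: "q = [:- ?z, 1:] ^ Polynomial.order ?z q * q2" "\<not> [:- ?z, 1:] dvd q2"
    using order_decomp[OF \<open>q \<noteq> 0\<close>] by blast
  have q2z: "poly q2 ?z \<noteq> 0" using q2(2) by (simp only: poly_eq_0_iff_dvd not_False_eq_True)
  define k where "k = Polynomial.order ?z q"
  have "((\<lambda>t. cmod (poly q2 (- \<i> * complex_of_real t))) \<longlongrightarrow> cmod (poly q2 ?z)) (at x)"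
    by (intro tendsto_intros)
  moreover have "\<forall>\<^sub>F t in at x. cmod (poly q2 (- \<i> * complex_of_real t)) = ?f t / \<bar>t - x\<bar> ^ k"
    using eventually_neq_at_within[of x x UNIV]
  proof eventually_elim
    case (elim t)
    have "- \<i> * complex_of_real t - ?z = - \<i> * complex_of_real (t - x)"
      by (simp add: algebra_simps)
    then have "cmod (- \<i> * complex_of_real t - ?z) = \<bar>t - x\<bar>"
      by (simp only: norm_mult norm_of_real) simp
    moreover have "poly q w = (w - ?z) ^ k * poly q2 w" for w
      by (subst q2(1), fold k_def) (simp add: algebra_simps)
    ultimately show ?case using elim by (simp only: norm_mult norm_power) simp
  qed
  ultimately have "((\<lambda>t. ?f t / \<bar>t - x\<bar> ^ k) \<longlongrightarrow> cmod (poly q2 ?z)) (at x)"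
    by (rule Lim_transform_eventually)
  \<comment> \<open>\<open>l j\<close> is the leading Taylor coefficient of branch \<open>j\<close>
    at \<open>x\<close>, nonzero by \<open>vanish_order_limit\<close>.\<close>
  moreover define l where
    "l = (\<lambda>j. (deriv ^^ vanish_order (\<mu> j) x) (\<mu> j) x / fact (vanish_order (\<mu> j) x))"
  have "((\<lambda>t. cmod C * \<bar>\<Prod>j<N. \<mu> j t / (t - x) ^ vanish_order (\<mu> j) x\<bar>)
      \<longlongrightarrow> cmod C * \<bar>\<Prod>j<N. l j\<bar>) (at x)"
    by (intro tendsto_intros) (auto simp: l_def intro!: vanish_order_limit(2) an nz)
  moreover have "cmod C * \<bar>\<Prod>j<N. \<mu> j t / (t - x) ^ vanish_order (\<mu> j) x\<bar> = ?f t / \<bar>t - x\<bar> ^ ?M" for t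
    unfolding q by (simp add: norm_mult prod_dividef power_sum [symmetric] power_abs abs_mult norm_of_real del: of_real_prod)
  moreover have "cmod C * \<bar>\<Prod>j<N. l j\<bar> \<noteq> 0"
    using \<open>C \<noteq> 0\<close> vanish_order_limit(1)[OF an nz] by (auto simp: l_def)
  ultimately show ?thesis
    using exponent_eq_of_limits[of ?f x k _ ?M] q2z k_def by auto
qed

text \<open>Each half-line is treated separately, starting from a point \<open>a\<close> between 0
  and the nearest element of \<open>R\<close> on that side. Thus 0 enters only through its one-sided
  signs and never as a jump, even if \<open>0 \<in> R\<close>.\<close>

lemma sgn_at_infinity_jumps:
  fixes f :: "real \<Rightarrow> real"
  assumes an: "real_analytic f" and R: "finite R" "\<And>x. x \<notin> R \<Longrightarrow> f x \<noteq> 0"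
  shows "\<forall>\<^sub>F b in at_top. sgn (f b) - sgn_right f 0
      = (\<Sum>x\<in>{x\<in>R. x > 0}. sgn_right f x - sgn_left f x)"
    and "\<forall>\<^sub>F b in at_bot. sgn_left f 0 - sgn (f b)
      = (\<Sum>x\<in>{x\<in>R. x < 0}. sgn_right f x - sgn_left f x)"
proof -
  have nz: "\<exists>\<^sub>F y in at x. f y \<noteq> 0" for x
  proof (rule eventually_frequently)
    show "\<forall>\<^sub>F y in at x. f y \<noteq> 0"
      using eventually_notin_finite[OF R(1)] by eventually_elim (rule R(2))
  qed simp
  note side = sgn_at_side[OF an nz, folded sgn_right_def, folded sgn_left_def]
  note jumps = sgn_change_eq_sum_jumps[OF real_analytic_continuous[OF an] side]
  have "\<forall>\<^sub>F a in at_right 0. sgn (f a) = sgn_right f 0 \<and> a > 0 \<and> (\<forall>x\<in>{x\<in>R. x > 0}. a < x)"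
    by (intro eventually_conj side(1) eventually_at_right_less eventually_ball_finite ballI
        eventually_at_right_lt) (use R(1) in auto)
  then obtain a where a: "sgn (f a) = sgn_right f 0" "a > 0" "\<And>x. x \<in> R \<Longrightarrow> x > 0 \<Longrightarrow> a < x"
    using eventually_happens'[OF trivial_limit_at_right_real] by blast
  have "\<forall>\<^sub>F b in at_top. b > a \<and> (\<forall>x\<in>R. x < b)"
    using R(1) by (auto simp: eventually_conj_iff eventually_ball_finite_distrib eventually_gt_at_top)
  then show "\<forall>\<^sub>F b in at_top. sgn (f b) - sgn_right f 0
      = (\<Sum>x\<in>{x\<in>R. x > 0}. sgn_right f x - sgn_left f x)"
  proof eventually_elim
    case (elim b)
    show ?case unfolding a(1)[symmetric]
      by (rule jumps) (use elim a R in \<open>auto intro: less_imp_le less_le_trans\<close>)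
  qed
  have "\<forall>\<^sub>F a in at_left 0. sgn (f a) = sgn_left f 0 \<and> a < 0 \<and> (\<forall>x\<in>{x\<in>R. x < 0}. x < a)"
    by (intro eventually_conj side(2) eventually_at_left_less eventually_ball_finite ballI
        eventually_at_left_gt) (use R(1) in auto)
  then obtain a where a: "sgn (f a) = sgn_left f 0" "a < 0" "\<And>x. x \<in> R \<Longrightarrow> x < 0 \<Longrightarrow> x < a"
    using eventually_happens'[OF trivial_limit_at_left_real] by blast
  have "\<forall>\<^sub>F b in at_bot. b < a \<and> (\<forall>x\<in>R. b < x)"
    using R(1) by (auto simp: eventually_conj_iff eventually_ball_finite_distrib eventually_gt_at_bot)
  then show "\<forall>\<^sub>F b in at_bot. sgn_left f 0 - sgn (f b)
      = (\<Sum>x\<in>{x\<in>R. x < 0}. sgn_right f x - sgn_left f x)"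
  proof eventually_elim
    case (elim b)
    show ?case unfolding a(1)[symmetric]
      by (rule jumps) (use elim a R in \<open>auto intro: less_imp_le le_less_trans\<close>)
  qed
qed

section \<open>Growth and limiting signs of the branches at infinity\<close>

lemma bounded_family_convergent_subseq:
  fixes s :: "nat \<Rightarrow> nat \<Rightarrow> real"
  assumes "\<And>j. j < N \<Longrightarrow> bounded (range (s j))"
  shows "\<exists>r \<nu>. strict_mono r \<and> (\<forall>j<N. (s j \<circ> r) \<longlonglongrightarrow> \<nu> j)"
  using assms
proof (induction N)
  case 0
  show ?case by (rule exI[of _ id]) (simp add: strict_mono_def)
next
  case (Suc N)
  then obtain r \<nu> where r: "strict_mono r" "\<And>j. j < N \<Longrightarrow> (s j \<circ> r) \<longlonglongrightarrow> \<nu> j"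
    by fastforce
  have "bounded (range (s N \<circ> r))"
    by (rule bounded_subset[OF Suc.prems[of N]]) auto
  then obtain l r' where r': "strict_mono r'" "((s N \<circ> r) \<circ> r') \<longlonglongrightarrow> l"
    using bounded_imp_convergent_subsequence[of "s N \<circ> r"] by blast
  have "(s j \<circ> (r \<circ> r')) \<longlonglongrightarrow> (\<nu>(N := l)) j" if "j < Suc N" for j
    using that LIMSEQ_subseq_LIMSEQ[OF r(2) r'(1), of j] r'(2) by (auto simp: less_Suc_eq o_assoc)
  moreover have "strict_mono (r \<circ> r')" by (rule strict_mono_o) fact+
  ultimately show ?case by blast
qed

text \<open>The eigenvalue equation is read in a row where the eigenvector has an entry of largest
  modulus \<open>m\<close>, and \<open>m\<close> is cancelled.\<close>

lemma eigenvalue_norm_le: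
  fixes A :: "complex mat"
  assumes A: "A \<in> carrier_mat n n" and "eigenvalue A k"
    and C: "\<And>i j. i < n \<Longrightarrow> j < n \<Longrightarrow> cmod (A $$ (i, j)) \<le> C"
  shows "cmod k \<le> real n * C"
proof -
  obtain v where v: "v \<in> carrier_vec n" "v \<noteq> 0\<^sub>v n" "A *\<^sub>v v = k \<cdot>\<^sub>v v"
    using assms(2) A unfolding eigenvalue_def eigenvector_def by auto
  then obtain i0 where i0: "i0 < n" "v $ i0 \<noteq> 0"
    by (metis carrier_vecD eq_vecI index_zero_vec)
  define m where "m = Max ((\<lambda>i. cmod (v $ i)) ` {..<n})"
  have le: "cmod (v $ i) \<le> m" if "i < n" for i unfolding m_def using that by (intro Max_ge) auto
  have "m \<in> (\<lambda>i. cmod (v $ i)) ` {..<n}" unfolding m_def using i0 by (intro Max_in) auto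
  then obtain i where i: "i < n" "cmod (v $ i) = m" by auto
  have "m > 0" using le[OF i0(1)] i0(2) by (smt (verit) zero_less_norm_iff)
  have "C \<ge> 0" using C[OF i(1) i(1)] norm_ge_zero order_trans by blast
  have "cmod k * m = cmod ((A *\<^sub>v v) $ i)"
    unfolding v(3) using i v(1) by (simp add: norm_mult)
  also have "(A *\<^sub>v v) $ i = (\<Sum>j<n. A $$ (i, j) * v $ j)"
    using A v(1) i(1) by (auto simp: scalar_prod_def lessThan_atLeast0 intro!: sum.cong)
  also have "cmod \<dots> \<le> (\<Sum>j<n. C * m)"
    by (rule order_trans[OF norm_sum sum_mono])
      (use i(1) C le \<open>C \<ge> 0\<close> in \<open>auto simp: norm_mult intro!: mult_mono\<close>)
  also have "\<dots> = (real n * C) * m" by simp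
  finally show ?thesis using \<open>m > 0\<close> by simp
qed

lemma tendsto_det:
  fixes M :: "'b \<Rightarrow> complex mat"
  assumes "\<And>k. M k \<in> carrier_mat n n" "A \<in> carrier_mat n n"
    and "\<And>i j. i < n \<Longrightarrow> j < n \<Longrightarrow> ((\<lambda>k. M k $$ (i, j)) \<longlongrightarrow> A $$ (i, j)) F"
  shows "((\<lambda>k. det (M k)) \<longlongrightarrow> det A) F"
  unfolding det_def'[OF assms(1)] det_def'[OF assms(2)]
  by (intro tendsto_intros assms(3)) (auto dest: permutes_in_image)

lemma pencil_carrier:
  assumes "L \<in> carrier_mat N N" "K \<in> carrier_mat N N"
  shows "pencil L K t \<in> carrier_mat N N"
  unfolding pencil_def by (rule minus_carrier_mat) (use assms in simp)

lemma det_pencil_eq_prod: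
  assumes "L \<in> carrier_mat N N" "K \<in> carrier_mat N N" "eigen_branches L K N \<mu>"
  shows "det (pencil L K (complex_of_real t)) = complex_of_real (\<Prod>j<N. \<mu> j t)"
proof -
  let ?A = "pencil L K (complex_of_real t)"
  have A: "?A \<in> carrier_mat N N" by (rule pencil_carrier) fact+
  have "- char_matrix ?A 0 = (-1) \<cdot>\<^sub>m ?A"
    using A by (intro eq_matI) (auto simp: char_matrix_def)
  then have "poly (char_poly ?A) 0 = (-1) ^ N * det ?A"
    using A by (simp add: char_poly_matrix[OF A])
  also have "poly (char_poly ?A) 0 = (-1) ^ N * complex_of_real (\<Prod>j<N. \<mu> j t)"
    using assms(3) unfolding eigen_branches_def by (simp add: poly_prod prod_uminus)
  finally show ?thesis by simp
qed

text \<open>The matrix entries are affine in \<open>t\<close>, so \<open>eigenvalue_norm_le\<close>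
  gives at most linear growth. This bounds the quotients \<open>\<mu> j t / t\<close> away from
  0.\<close>

lemma branch_bound:
  assumes L: "L \<in> carrier_mat N N" and K: "K \<in> carrier_mat N N" and br: "eigen_branches L K N \<mu>"
  shows "\<exists>C. \<forall>t j. j < N \<longrightarrow> \<bar>\<mu> j t\<bar> \<le> C * (1 + \<bar>t\<bar>)"
proof -
  define B where "B = (\<Sum>i<N. \<Sum>j<N. cmod (L $$ (i, j)) + cmod (K $$ (i, j)))"
  have B: "cmod (L $$ (i, j)) + cmod (K $$ (i, j)) \<le> B" if "i < N" "j < N" for i j
  proof -
    have "cmod (L $$ (i, j)) + cmod (K $$ (i, j)) \<le> (\<Sum>j<N. cmod (L $$ (i, j)) + cmod (K $$ (i, j)))"
      by (rule member_le_sum) (use that in auto)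
    also have "\<dots> \<le> B" unfolding B_def by (rule member_le_sum) (use that in \<open>auto simp: sum.distrib intro!: add_nonneg_nonneg sum_nonneg\<close>)
    finally show ?thesis .
  qed
  have "\<bar>\<mu> j t\<bar> \<le> real N * (B * (1 + \<bar>t\<bar>))" if j: "j < N" for j t
  proof -
    let ?A = "pencil L K (complex_of_real t)"
    have A: "?A \<in> carrier_mat N N" by (rule pencil_carrier) fact+
    have "poly (char_poly ?A) (complex_of_real (\<mu> j t)) = 0"
      using br j unfolding eigen_branches_def by (auto simp: poly_prod)
    then have ev: "eigenvalue ?A (complex_of_real (\<mu> j t))"
      by (simp add: eigenvalue_root_char_poly[OF A])
    have "cmod (?A $$ (i, k)) \<le> B * (1 + \<bar>t\<bar>)" if "i < N" "k < N" for i k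
    proof -
      have "cmod (?A $$ (i, k)) \<le> cmod (L $$ (i, k)) + \<bar>t\<bar> * cmod (K $$ (i, k))"
        using L K that norm_triangle_ineq4[of "L $$ (i, k)" "complex_of_real t * K $$ (i, k)"]
        by (simp add: pencil_def norm_mult)
      also have "\<dots> \<le> (cmod (L $$ (i, k)) + cmod (K $$ (i, k))) * (1 + \<bar>t\<bar>)"
        by (simp add: algebra_simps)
      also have "\<dots> \<le> B * (1 + \<bar>t\<bar>)" by (rule mult_right_mono[OF B[OF that]]) simp
      finally show ?thesis .
    qed
    from eigenvalue_norm_le[OF A ev this] show ?thesis by simp
  qed
  then show ?thesis by (intro exI[of _ "real N * B"]) (simp add: mult.assoc)
qed

text \<open>Divided by \<open>t\<close>, the pencil tends to \<open>- K\<close>. The quotients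
  \<open>\<mu> j t / t\<close> are bounded, hence converge along a common subsequence, and comparing
  characteristic polynomials identifies the limits as the eigenvalues of \<open>- K\<close>. These
  are nonzero since \<open>det K \<noteq> 0\<close>, so they fix the signs. A subsequence is enough
  because \<open>sgn_at_infinity_jumps\<close> makes each sign eventually constant.\<close>

lemma branches_at_infinity:
  assumes L: "L \<in> carrier_mat N N" and K: "K \<in> carrier_mat N N" and br: "eigen_branches L K N \<mu>"
    and "det K \<noteq> 0" and t: "filterlim t at_infinity sequentially"
  obtains r \<nu> where "strict_mono r" "\<And>z. complex_of_real (\<Prod>j<N. z - \<nu> j) = det (complex_of_real z \<cdot>\<^sub>m 1\<^sub>m N + K)"
    "\<And>j. j < N \<Longrightarrow> \<forall>\<^sub>F k in sequentially. sgn (\<mu> j (t (r k))) = sgn (t (r k)) * sgn (\<nu> j)"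
proof -
  obtain C where C: "\<And>t j. j < N \<Longrightarrow> \<bar>\<mu> j t\<bar> \<le> C * (1 + \<bar>t\<bar>)"
    using branch_bound[OF L K br] by blast
  have ge1: "\<forall>\<^sub>F k in sequentially. \<bar>t k\<bar> \<ge> 1"
    using t unfolding filterlim_at_infinity[OF order_refl] by (auto dest!: spec[of _ 1])
  have "Bseq (\<lambda>k. \<mu> j (t k) / t k)" if j: "j < N" for j
  proof (rule BfunI)
    show "\<forall>\<^sub>F k in sequentially. norm (\<mu> j (t k) / t k) \<le> C * 2"
      using ge1
    proof eventually_elim
      case (elim k)
      have "C \<ge> 0" using C[OF j, of 0] by simp
      then have "C * (1 + \<bar>t k\<bar>) \<le> C * 2 * \<bar>t k\<bar>"
        unfolding mult.assoc using elim by (intro mult_left_mono) auto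
      then have "\<bar>\<mu> j (t k)\<bar> \<le> C * 2 * \<bar>t k\<bar>" using C[OF j, of "t k"] by simp
      then show ?case using elim by (simp add: field_simps)
    qed
  qed
  then have "bounded (range (\<lambda>k. \<mu> j (t k) / t k))" if "j < N" for j
    using that by (simp add: Bseq_eq_bounded)
  from bounded_family_convergent_subseq[of N "\<lambda>j k. \<mu> j (t k) / t k", OF this]
  obtain r \<nu> where r: "strict_mono r"
    and lim: "\<And>j. j < N \<Longrightarrow> (\<lambda>k. \<mu> j (t (r k)) / t (r k)) \<longlonglongrightarrow> \<nu> j"
    by (auto simp: o_def)
  have tr: "filterlim (\<lambda>k. t (r k)) at_infinity sequentially"
    by (rule filterlim_compose[OF t filterlim_subseq[OF r]])
  have nz: "\<forall>\<^sub>F k in sequentially. t (r k) \<noteq> 0"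
    using tr unfolding filterlim_at_infinity[OF order_refl]
    by (auto dest!: spec[of _ 1] elim: eventually_mono)
  have prod: "complex_of_real (\<Prod>j<N. z - \<nu> j) = det (complex_of_real z \<cdot>\<^sub>m 1\<^sub>m N + K)" for z
  proof -
    define M where "M = (\<lambda>s. complex_of_real z \<cdot>\<^sub>m 1\<^sub>m N + K - complex_of_real s \<cdot>\<^sub>m L)"
    have M: "M s \<in> carrier_mat N N" for s unfolding M_def using L K by auto
    have "(\<lambda>k. inverse (t (r k))) \<longlonglongrightarrow> 0"
      by (rule filterlim_compose[OF tendsto_inverse_0 tr])
    from tendsto_of_real[OF this, where 'a = complex]
    have inv: "(\<lambda>k. complex_of_real (inverse (t (r k)))) \<longlonglongrightarrow> 0"
      by simp
    have "(\<lambda>k. det (M (inverse (t (r k))))) \<longlonglongrightarrow> det (complex_of_real z \<cdot>\<^sub>m 1\<^sub>m N + K)"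
    proof (rule tendsto_det[OF M])
      fix i j assume ij: "i < N" "j < N"
      have "(\<lambda>k. (complex_of_real z \<cdot>\<^sub>m 1\<^sub>m N + K) $$ (i, j) - complex_of_real (inverse (t (r k))) * L $$ (i, j))
          \<longlonglongrightarrow> (complex_of_real z \<cdot>\<^sub>m 1\<^sub>m N + K) $$ (i, j) - 0 * L $$ (i, j)"
        by (intro tendsto_intros inv)
      then show "(\<lambda>k. M (inverse (t (r k))) $$ (i, j)) \<longlonglongrightarrow> (complex_of_real z \<cdot>\<^sub>m 1\<^sub>m N + K) $$ (i, j)"
        using ij L K by (simp add: M_def)
    qed (use K in auto)
    moreover have "\<forall>\<^sub>F k in sequentially. det (M (inverse (t (r k))))
        = complex_of_real (\<Prod>j<N. z - \<mu> j (t (r k)) / t (r k))"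
      using nz
    proof eventually_elim
      case (elim k)
      define s where "s = t (r k)"
      have s: "s \<noteq> 0" using elim by (simp add: s_def)
      let ?A = "pencil L K (complex_of_real s)"
      have A: "?A \<in> carrier_mat N N" by (rule pencil_carrier) fact+
      \<comment> \<open>Rescaling by \<open>s\<close> turns \<open>z + K - L / s\<close> into
        \<open>s z - (L - s K)\<close>, whose determinant is the characteristic polynomial of the
        pencil at \<open>s z\<close> and hence a product over the branches.\<close>
      have eq: "M (inverse s) = complex_of_real (inverse s) \<cdot>\<^sub>m (- char_matrix ?A (complex_of_real (s * z)))"
        using L K s by (intro eq_matI) (auto simp: M_def char_matrix_def pencil_def field_simps)
      have "det (M (inverse s)) = complex_of_real (inverse s) ^ N * poly (char_poly ?A) (complex_of_real (s * z))"
        unfolding eq char_poly_matrix[OF A] using L K by (simp add: char_matrix_def pencil_def)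
      also have "poly (char_poly ?A) (complex_of_real (s * z)) = complex_of_real (\<Prod>j<N. s * z - \<mu> j s)"
        using br unfolding eigen_branches_def by (simp add: poly_prod)
      also have "complex_of_real (inverse s) ^ N * \<dots> = complex_of_real (\<Prod>j<N. inverse s * (s * z - \<mu> j s))"
        by (simp add: prod.distrib)
      also have "(\<Prod>j<N. inverse s * (s * z - \<mu> j s)) = (\<Prod>j<N. z - \<mu> j s / s)"
        using s by (intro prod.cong) (auto simp: field_simps)
      finally show ?case by (simp add: s_def)
    qed
    ultimately have "(\<lambda>k. complex_of_real (\<Prod>j<N. z - \<mu> j (t (r k)) / t (r k)))
        \<longlonglongrightarrow> det (complex_of_real z \<cdot>\<^sub>m 1\<^sub>m N + K)"
      by (rule Lim_transform_eventually)
    moreover have "(\<lambda>k. complex_of_real (\<Prod>j<N. z - \<mu> j (t (r k)) / t (r k)))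
        \<longlonglongrightarrow> complex_of_real (\<Prod>j<N. z - \<nu> j)"
      by (intro tendsto_intros) (use lim in auto)
    ultimately show ?thesis using LIMSEQ_unique by blast
  qed
  have "complex_of_real 0 \<cdot>\<^sub>m 1\<^sub>m N + K = K" using K by (intro eq_matI) auto
  with prod[of 0] \<open>det K \<noteq> 0\<close> have "(\<Prod>j<N. 0 - \<nu> j) \<noteq> 0"
    by (metis of_real_0)
  then have \<nu>0: "\<nu> j \<noteq> 0" if "j < N" for j using that by auto
  have "\<forall>\<^sub>F k in sequentially. sgn (\<mu> j (t (r k))) = sgn (t (r k)) * sgn (\<nu> j)" if j: "j < N" for j
    using eventually_sgn_eq_of_limit[OF lim[OF j] \<nu>0[OF j]] nz
    by eventually_elim (auto simp: sgn_if zero_less_divide_iff divide_less_0_iff split: if_splits)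
  with r prod show thesis by (rule that)
qed

section \<open>Kernel dimension and multiplicity for Hermitian matrices\<close>

lemma hermitian_cscalar_prod:
  assumes A: "A \<in> carrier_mat n n" and herm: "hermitian_mat A"
    and v: "v \<in> carrier_vec n" and w: "w \<in> carrier_vec n"
  shows "(A *\<^sub>v v) \<bullet>c w = v \<bullet>c (A *\<^sub>v w)"
proof -
  have conj: "cnj (A $$ (i, j)) = A $$ (j, i)" if "i < n" "j < n" for i j
  proof -
    have "mat_adjoint A $$ (j, i) = conjugate (A $$ (i, j))"
      using A that by (simp add: mat_adjoint_def mat_of_rows_def)
    with herm show ?thesis by (simp add: hermitian_mat_def)
  qed
  have "(A *\<^sub>v v) \<bullet>c w = (\<Sum>i<n. \<Sum>j<n. A $$ (i, j) * v $ j * conjugate (w $ i))"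
    using A v w by (simp add: scalar_prod_def lessThan_atLeast0 sum_distrib_right)
  also have "\<dots> = (\<Sum>j<n. \<Sum>i<n. A $$ (i, j) * v $ j * conjugate (w $ i))"
    by (rule sum.swap)
  also have "\<dots> = (\<Sum>j<n. v $ j * (\<Sum>i<n. conjugate (A $$ (j, i) * w $ i)))"
    unfolding sum_distrib_left by (intro sum.cong refl) (simp add: conj mult_ac)
  also have "\<dots> = v \<bullet>c (A *\<^sub>v w)"
    using A v w by (simp add: scalar_prod_def lessThan_atLeast0 sum_conjugate)
  finally show ?thesis .
qed

text \<open>If \<open>A (A v) = 0\<close>, then the squared norm of \<open>A v\<close> equals the
  inner product of \<open>A (A v)\<close> with \<open>v\<close>, which is 0.\<close>

lemma hermitian_kernel_square:
  assumes A: "A \<in> carrier_mat n n" and "hermitian_mat A"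
  shows "mat_kernel (A * A) = mat_kernel A"
proof
  show "mat_kernel A \<subseteq> mat_kernel (A * A)" by (rule mat_kernel_mult_subset[OF A A])
  show "mat_kernel (A * A) \<subseteq> mat_kernel A"
  proof
    fix v assume "v \<in> mat_kernel (A * A)"
    from mat_kernelD[OF mult_carrier_mat[OF A A] this]
    have v: "v \<in> carrier_vec n" and AAv: "A *\<^sub>v (A *\<^sub>v v) = 0\<^sub>v n" using A by auto
    have Av: "A *\<^sub>v v \<in> carrier_vec n" using A v by simp
    have "(A *\<^sub>v v) \<bullet>c (A *\<^sub>v v) = (A *\<^sub>v (A *\<^sub>v v)) \<bullet>c v"
      using hermitian_cscalar_prod[OF assms Av v] by simp
    also have "\<dots> = 0" unfolding AAv using v by simp
    finally have "A *\<^sub>v v = 0\<^sub>v n" using conjugate_square_eq_0_vec[OF Av] by simp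
    with A v show "v \<in> mat_kernel A" by (rule mat_kernelI)
  qed
qed

text \<open>Since \<open>A\<close> and \<open>A * A\<close> have the same kernel, no Jordan block
  for 0 has size above 1, so the number of blocks equals their total size. This lets
  \<open>kernel_dim L\<close> be counted by branches vanishing at 0.\<close>

lemma hermitian_kernel_dim:
  fixes A :: "complex mat"
  assumes A: "A \<in> carrier_mat n n" and "hermitian_mat A"
  shows "kernel_dim A = alg_mult A 0"
proof -
  obtain n_as where jnf: "jordan_nf A n_as"
    using char_poly_factorized[OF A] jordan_nf_exists[OF A] by blast
  have cm: "char_matrix A 0 = A" using A by (intro eq_matI) (auto simp: char_matrix_def)
  \<comment> \<open>The sizes of the Jordan blocks for the eigenvalue 0; a block of size
    \<open>n\<close> contributes \<open>min k n\<close> to the kernel dimension of the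
    \<open>k\<close>-th power.\<close>
  define ns where "ns = map fst [(n, e)\<leftarrow>n_as. e = 0]"
  have pow: "A ^\<^sub>m 1 = A" "A ^\<^sub>m 2 = A * A" using A by (auto simp: numeral_2_eq_2)
  have d1: "kernel_dim A = (\<Sum>n\<leftarrow>ns. min 1 n)"
    using dim_gen_eigenspace[OF jnf, of 0 1]
    unfolding dim_gen_eigenspace_def cm pow ns_def .
  have d2: "kernel_dim (A * A) = (\<Sum>n\<leftarrow>ns. min 2 n)"
    using dim_gen_eigenspace[OF jnf, of 0 2]
    unfolding dim_gen_eigenspace_def cm pow ns_def .
  have "kernel_dim (A * A) = kernel_dim A"
    unfolding kernel_dim_def hermitian_kernel_square[OF assms] using A by simp
  then have eq: "(\<Sum>n\<leftarrow>ns. min 2 n) = (\<Sum>n\<leftarrow>ns. min 1 n)" using d1 d2 by simp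
  have "(\<Sum>n\<leftarrow>ns. min 1 n) = sum_list ns"
    using eq
  proof (induction ns)
    case (Cons m ns)
    have "(\<Sum>n\<leftarrow>ns. min 1 n) \<le> (\<Sum>n\<leftarrow>ns. min 2 n)" by (rule sum_list_mono) simp
    with Cons show ?case by (auto simp: min_def split: if_splits)
  qed simp
  also have "\<dots> = alg_mult A 0"
    unfolding alg_mult_def jordan_nf_order[OF jnf] ns_def by (simp add: case_prod_unfold)
  finally show ?thesis using d1 by simp
qed

section \<open>From the pencil to the spectrum of \<open>J * L\<close>, and counts of signs and
  eigenvalues\<close>

text \<open>As \<open>(\<i> J) K = 1\<close>, multiplying \<open>L - t K\<close> from the left by
  \<open>\<i> (\<i> J)\<close> yields \<open>- \<i> t - J L\<close>. Taking determinants gives the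
  constant.\<close>

lemma char_poly_imag_axis:
  assumes L: "L \<in> carrier_mat N N" and J: "J \<in> carrier_mat N N" and K: "K \<in> carrier_mat N N"
    and KJ: "K * (\<i> \<cdot>\<^sub>m J) = 1\<^sub>m N"
  shows "poly (char_poly (J * L)) (- \<i> * t) = \<i> ^ N * det (\<i> \<cdot>\<^sub>m J) * det (pencil L K t)"
proof -
  have iJ: "\<i> \<cdot>\<^sub>m J \<in> carrier_mat N N" using J by simp
  have P: "pencil L K t \<in> carrier_mat N N" by (rule pencil_carrier[OF L K])
  have JL: "J * L \<in> carrier_mat N N" using J L by simp
  have JK: "(\<i> \<cdot>\<^sub>m J) * K = 1\<^sub>m N" by (rule mat_mult_left_right_inverse[OF K iJ KJ])
  have tK: "t \<cdot>\<^sub>m K \<in> carrier_mat N N" using K by simp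
  have "(\<i> \<cdot>\<^sub>m J) * pencil L K t = \<i> \<cdot>\<^sub>m (J * L) - t \<cdot>\<^sub>m 1\<^sub>m N"
    unfolding pencil_def mult_minus_distrib_mat[OF iJ L tK] mult_smult_distrib[OF iJ K] JK
      mult_smult_assoc_mat[OF J L] ..
  moreover have "- char_matrix X (- \<i> * t) = \<i> \<cdot>\<^sub>m (\<i> \<cdot>\<^sub>m X - t \<cdot>\<^sub>m 1\<^sub>m N)"
    if "X \<in> carrier_mat N N" for X
    using that by (intro eq_matI) (auto simp: char_matrix_def algebra_simps)
  ultimately have "- char_matrix (J * L) (- \<i> * t) = \<i> \<cdot>\<^sub>m ((\<i> \<cdot>\<^sub>m J) * pencil L K t)"
    using JL by simp
  then show ?thesis
    using iJ P unfolding char_poly_matrix[OF JL] by (simp only: det_smult[of \<i> "_ * _"] det_mult) simp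
qed

text \<open>The limits obtained at the two ends need not be numbered alike, so only symmetric sums
  of them can be compared. Products agreeing at all real \<open>z\<close> come from equal
  polynomials.\<close>

lemma sum_eq_of_prod_linear_eq:
  fixes a b :: "nat \<Rightarrow> real" and f :: "real \<Rightarrow> real"
  assumes "\<And>z. (\<Prod>j<N. z - a j) = (\<Prod>j<N. z - b j)"
  shows "(\<Sum>j<N. f (a j)) = (\<Sum>j<N. f (b j))"
proof -
  have "(\<Prod>j<N. [:- a j, 1:]) = (\<Prod>j<N. [:- b j, 1:])"
    by (rule poly_eq_poly_eq_iff[THEN iffD1]) (simp add: fun_eq_iff poly_prod assms)
  then show ?thesis
    by (simp add: sum_prod_linear_roots[OF refl, of f])
qed

lemma sum_sgn_eq:
  fixes g :: "nat \<Rightarrow> real"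
  assumes "\<And>j. j < N \<Longrightarrow> g j \<noteq> 0"
  shows "(\<Sum>j<N. sgn (g j)) = real N - 2 * real (card {j. j < N \<and> g j < 0})"
proof -
  have "(\<Sum>j<N. sgn (g j)) = (\<Sum>j<N. 1 - 2 * of_bool (g j < 0))"
    using assms by (intro sum.cong) (auto simp: sgn_if not_less order_less_le)
  also have "\<dots> = real N - 2 * (\<Sum>j<N. of_bool (g j < 0))"
    by (simp add: sum_subtractf sum_distrib_left)
  also have "(\<Sum>j<N. of_bool (g j < 0)) = real (card {j. j < N \<and> g j < 0})"
    by (subst sum_of_bool_eq) (simp_all add: Collect_conj_eq lessThan_def)
  finally show ?thesis .
qed

text \<open>A branch is negative along \<open>F\<close> exactly if it is negative at 0, or vanishes
  there and turns downwards. Here \<open>g j\<close> is the sign along \<open>F\<close>; keeping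
  \<open>F\<close> general serves both sides of 0.\<close>

lemma branch_counts_at_0:
  fixes \<mu> :: "nat \<Rightarrow> real \<Rightarrow> real"
  assumes ev: "\<And>j. j < N \<Longrightarrow> \<forall>\<^sub>F t in F. sgn (\<mu> j t) = g j" and "F \<noteq> bot"
    and g: "\<And>j. j < N \<Longrightarrow> g j \<noteq> 0" "\<And>j. j < N \<Longrightarrow> \<mu> j 0 \<noteq> 0 \<Longrightarrow> sgn (\<mu> j 0) = g j"
  defines "Zd \<equiv> card {j. j < N \<and> \<mu> j 0 = 0 \<and> (\<forall>\<^sub>F t in F. \<mu> j t < 0)}"
    and "Zu \<equiv> card {j. j < N \<and> \<mu> j 0 = 0 \<and> (\<forall>\<^sub>F t in F. \<mu> j t > 0)}"
  shows "(\<Sum>j<N. g j) = real N - 2 * (real (card {j. j < N \<and> \<mu> j 0 < 0}) + real Zd)"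
    and "Zd + Zu = card {j. j < N \<and> \<mu> j 0 = 0}"
proof -
  have sgn_g: "sgn (g j) = g j" if "j < N" for j
    using eventually_happens'[OF \<open>F \<noteq> bot\<close> ev[OF that]] by (metis sgn_sgn)
  have neg: "(\<forall>\<^sub>F t in F. \<mu> j t < 0) \<longleftrightarrow> g j < 0" if j: "j < N" for j
  proof
    assume "\<forall>\<^sub>F t in F. \<mu> j t < 0"
    from eventually_happens'[OF \<open>F \<noteq> bot\<close> eventually_conj[OF this ev[OF j]]]
    show "g j < 0" by force
  next
    assume "g j < 0"
    with ev[OF j] show "\<forall>\<^sub>F t in F. \<mu> j t < 0" by (auto elim!: eventually_mono simp: sgn_if split: if_splits)
  qed
  have pos: "(\<forall>\<^sub>F t in F. \<mu> j t > 0) \<longleftrightarrow> g j > 0" if j: "j < N" for j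
  proof
    assume "\<forall>\<^sub>F t in F. \<mu> j t > 0"
    from eventually_happens'[OF \<open>F \<noteq> bot\<close> eventually_conj[OF this ev[OF j]]]
    show "g j > 0" by force
  next
    assume "g j > 0"
    with ev[OF j] show "\<forall>\<^sub>F t in F. \<mu> j t > 0" by (auto elim!: eventually_mono simp: sgn_if split: if_splits)
  qed
  have Zd: "Zd = card {j. j < N \<and> \<mu> j 0 = 0 \<and> g j < 0}"
    unfolding Zd_def using neg by (intro arg_cong[of _ _ card]) auto
  have Zu: "Zu = card {j. j < N \<and> \<mu> j 0 = 0 \<and> g j > 0}"
    unfolding Zu_def using pos by (intro arg_cong[of _ _ card]) auto
  have split: "{j. j < N \<and> g j < 0} = {j. j < N \<and> \<mu> j 0 < 0} \<union> {j. j < N \<and> \<mu> j 0 = 0 \<and> g j < 0}"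
  proof (rule Set.set_eqI)
    fix j
    show "j \<in> {j. j < N \<and> g j < 0} \<longleftrightarrow>
        j \<in> {j. j < N \<and> \<mu> j 0 < 0} \<union> {j. j < N \<and> \<mu> j 0 = 0 \<and> g j < 0}"
      using g(2)[of j] by (cases "j < N"; cases "\<mu> j 0" "0::real" rule: linorder_cases) auto
  qed
  have "(\<Sum>j<N. g j) = (\<Sum>j<N. sgn (g j))" by (rule sum.cong) (auto simp: sgn_g)
  also have "\<dots> = real N - 2 * real (card {j. j < N \<and> g j < 0})" by (rule sum_sgn_eq) (rule g(1))
  also have "card {j. j < N \<and> g j < 0} = card {j. j < N \<and> \<mu> j 0 < 0} + Zd"
    unfolding split Zd by (rule card_Un_disjoint) auto
  finally show "(\<Sum>j<N. g j) = real N - 2 * (real (card {j. j < N \<and> \<mu> j 0 < 0}) + real Zd)" by simp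
  have "{j. j < N \<and> \<mu> j 0 = 0} = {j. j < N \<and> \<mu> j 0 = 0 \<and> g j < 0} \<union> {j. j < N \<and> \<mu> j 0 = 0 \<and> g j > 0}"
    using g(1) by (auto simp: not_less order_less_le)
  then have "card {j. j < N \<and> \<mu> j 0 = 0}
      = card ({j. j < N \<and> \<mu> j 0 = 0 \<and> g j < 0} \<union> {j. j < N \<and> \<mu> j 0 = 0 \<and> g j > 0})"
    by (rule arg_cong)
  also have "\<dots> = Zd + Zu" unfolding Zd Zu by (rule card_Un_disjoint) auto
  finally show "Zd + Zu = card {j. j < N \<and> \<mu> j 0 = 0}" ..
qed

text \<open>The signs at the two ends have opposite sums, both determined by the eigenvalues of
  \<open>- K\<close>. Subtracting the relation for the positive half-line from that for the negative
  one cancels them and leaves only the signs at 0.\<close>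

lemma sum_sgn_at_0_eq_jumps:
  assumes L: "L \<in> carrier_mat N N" and K: "K \<in> carrier_mat N N" and br: "eigen_branches L K N \<mu>"
    and "det K \<noteq> 0" and R: "finite R" "\<And>x j. x \<notin> R \<Longrightarrow> j < N \<Longrightarrow> \<mu> j x \<noteq> 0"
  shows "(\<Sum>j<N. sgn_right (\<mu> j) 0) + (\<Sum>j<N. sgn_left (\<mu> j) 0)
    = (\<Sum>j<N. \<Sum>x\<in>{x\<in>R. x < 0}. sgn_right (\<mu> j) x - sgn_left (\<mu> j) x)
    - (\<Sum>j<N. \<Sum>x\<in>{x\<in>R. x > 0}. sgn_right (\<mu> j) x - sgn_left (\<mu> j) x)"
proof -
  have an: "real_analytic (\<mu> j)" if "j < N" for j using br that by (simp add: eigen_branches_def)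
  note jumps = sgn_at_infinity_jumps[OF an R(1) R(2)]
  define t where "t = (\<lambda>k. real (Suc k))"
  have t: "filterlim t at_top sequentially" unfolding t_def
    by (rule filterlim_compose[OF filterlim_real_sequentially filterlim_Suc])
  then have t': "filterlim (\<lambda>k. - t k) at_bot sequentially"
    by (simp add: filterlim_uminus_at_top)
  have tpos: "t k > 0" for k by (simp add: t_def)
  obtain r \<nu> where r: "strict_mono r"
    and \<nu>: "\<And>z. complex_of_real (\<Prod>j<N. z - \<nu> j) = det (complex_of_real z \<cdot>\<^sub>m 1\<^sub>m N + K)"
    and s: "\<And>j. j < N \<Longrightarrow> \<forall>\<^sub>F k in sequentially. sgn (\<mu> j (t (r k))) = sgn (t (r k)) * sgn (\<nu> j)"
    using branches_at_infinity[OF L K br \<open>det K \<noteq> 0\<close> filterlim_at_top_imp_at_infinity[OF t]] by blast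
  obtain r' \<nu>' where r': "strict_mono r'"
    and \<nu>': "\<And>z. complex_of_real (\<Prod>j<N. z - \<nu>' j) = det (complex_of_real z \<cdot>\<^sub>m 1\<^sub>m N + K)"
    and s': "\<And>j. j < N \<Longrightarrow> \<forall>\<^sub>F k in sequentially. sgn (\<mu> j (- t (r' k))) = sgn (- t (r' k)) * sgn (\<nu>' j)"
    using branches_at_infinity[OF L K br \<open>det K \<noteq> 0\<close> filterlim_at_bot_imp_at_infinity[OF t']] by blast
  \<comment> \<open>One sufficiently late term of the subsequence realises both the jump formula and
    the limiting sign.\<close>
  have plus: "sgn (\<nu> j) - sgn_right (\<mu> j) 0 = (\<Sum>x\<in>{x\<in>R. x > 0}. sgn_right (\<mu> j) x - sgn_left (\<mu> j) x)"
    if j: "j < N" for j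
  proof -
    have "filterlim (\<lambda>k. t (r k)) at_top sequentially"
      by (rule filterlim_compose[OF t filterlim_subseq[OF r]])
    from filterlim_iff[THEN iffD1, OF this, rule_format, OF jumps(1)[OF j _ j]]
    have "\<forall>\<^sub>F k in sequentially. sgn (\<mu> j (t (r k))) - sgn_right (\<mu> j) 0
        = (\<Sum>x\<in>{x\<in>R. x > 0}. sgn_right (\<mu> j) x - sgn_left (\<mu> j) x)" .
    from eventually_happens'[OF sequentially_bot eventually_conj[OF this s[OF j]]]
    show ?thesis using tpos by auto
  qed
  \<comment> \<open>At the negative end the denominator is negative, so the branch has sign
    \<open>- sgn (\<nu>' j)\<close>; this accounts for the plus sign.\<close>
  have minus: "sgn_left (\<mu> j) 0 + sgn (\<nu>' j) = (\<Sum>x\<in>{x\<in>R. x < 0}. sgn_right (\<mu> j) x - sgn_left (\<mu> j) x)"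
    if j: "j < N" for j
  proof -
    have "filterlim (\<lambda>k. - t (r' k)) at_bot sequentially"
      by (rule filterlim_compose[OF t' filterlim_subseq[OF r']])
    from filterlim_iff[THEN iffD1, OF this, rule_format, OF jumps(2)[OF j _ j]]
    have "\<forall>\<^sub>F k in sequentially. sgn_left (\<mu> j) 0 - sgn (\<mu> j (- t (r' k)))
        = (\<Sum>x\<in>{x\<in>R. x < 0}. sgn_right (\<mu> j) x - sgn_left (\<mu> j) x)" .
    from eventually_happens'[OF sequentially_bot eventually_conj[OF this s'[OF j]]]
    show ?thesis using tpos by auto
  qed
  have "(\<Prod>j<N. z - \<nu> j) = (\<Prod>j<N. z - \<nu>' j)" for z
    using \<nu>[of z] \<nu>'[of z] by (metis of_real_eq_iff)
  then have eq: "(\<Sum>j<N. sgn (\<nu> j)) = (\<Sum>j<N. sgn (\<nu>' j))" by (rule sum_eq_of_prod_linear_eq)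
  have "(\<Sum>j<N. sgn (\<nu> j)) - (\<Sum>j<N. sgn_right (\<mu> j) 0)
      = (\<Sum>j<N. \<Sum>x\<in>{x\<in>R. x > 0}. sgn_right (\<mu> j) x - sgn_left (\<mu> j) x)"
    unfolding sum_subtractf[symmetric] by (rule sum.cong) (auto simp: plus sum_subtractf)
  moreover have "(\<Sum>j<N. sgn_left (\<mu> j) 0) + (\<Sum>j<N. sgn (\<nu>' j))
      = (\<Sum>j<N. \<Sum>x\<in>{x\<in>R. x < 0}. sgn_right (\<mu> j) x - sgn_left (\<mu> j) x)"
    unfolding sum.distrib[symmetric] by (rule sum.cong) (auto simp: minus)
  ultimately show ?thesis using eq by linarith
qed

text \<open>An eigenvalue is off the imaginary axis, or 0, or of the form \<open>- \<i> x\<close>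
  with \<open>x \<noteq> 0\<close> in \<open>R\<close>; in the last case \<open>x\<close> is minus
  its imaginary part.\<close>

lemma total_multiplicity:
  assumes A: "A \<in> carrier_mat N N"
    and R: "\<And>x. x \<in> R \<longleftrightarrow> poly (char_poly A) (- \<i> * complex_of_real x) = 0"
  shows "N = alg_mult_in A {z. Re z \<noteq> 0} + alg_mult A 0
    + (\<Sum>x\<in>R - {0}. alg_mult A (- \<i> * complex_of_real x))"
proof -
  let ?f = "\<lambda>x. - \<i> * complex_of_real x"
  obtain as where as: "char_poly A = (\<Prod>a\<leftarrow>as. [:- a, 1:])" "length as = N"
    using char_poly_factorized[OF A] by blast
  define c where "c = (\<lambda>j. as ! j)"
  have cp: "char_poly A = (\<Prod>j<N. [:- c j, 1:])"
    unfolding as(1) prod.list_conv_set_nth by (simp add: as(2) c_def lessThan_atLeast0)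
  have root: "poly (char_poly A) (c j) = 0" if "j < N" for j
    using that by (auto simp: cp poly_prod)
  let ?T = "?f ` (R - {0})"
  have split: "{..<N} = {j. j < N \<and> c j \<in> {z. Re z \<noteq> 0}} \<union> {j. j < N \<and> c j = 0} \<union> {j. j < N \<and> c j \<in> ?T}"
  proof -
    have "c j \<in> ?T" if "j < N" "Re (c j) = 0" "c j \<noteq> 0" for j
    proof -
      have "c j = ?f (- Im (c j))" using that(2) by (simp add: complex_eq_iff)
      moreover from this have "- Im (c j) \<in> R" using R root[OF that(1)] by metis
      moreover have "- Im (c j) \<noteq> 0" using that by (simp add: complex_eq_iff)
      ultimately show ?thesis by blast
    qed
    then show ?thesis by auto
  qed
  have "alg_mult_in A ?T = (\<Sum>a\<in>?T. alg_mult A a)"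
    unfolding alg_mult_in_def by (rule sum.cong) (use R in auto)
  also have "\<dots> = (\<Sum>x\<in>R - {0}. alg_mult A (?f x))"
    by (subst sum.reindex) (auto simp: inj_on_def)
  finally have T: "card {j. j < N \<and> c j \<in> ?T} = (\<Sum>x\<in>R - {0}. alg_mult A (?f x))"
    by (simp only: alg_mult_in_eq_card[OF cp])
  have "N = card {..<N}" by simp
  also have "\<dots> = card {j. j < N \<and> c j \<in> {z. Re z \<noteq> 0}} + card {j. j < N \<and> c j = 0}
      + card {j. j < N \<and> c j \<in> ?T}"
    unfolding split by (subst card_Un_disjoint; (subst card_Un_disjoint)?) auto
  also have "card {j. j < N \<and> c j = 0} = alg_mult A 0"
    unfolding alg_mult_def cp order_prod_linear ..
  finally show ?thesis unfolding T alg_mult_in_eq_card[OF cp] .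
qed

section \<open>Elimination between multiplicities and sign changes\<close>

theorem theorem7:
  fixes n :: nat and L J K :: "complex mat" and \<mu> :: "nat \<Rightarrow> real \<Rightarrow> real"
  assumes L: "L \<in> carrier_mat (2*n) (2*n)" and J: "J \<in> carrier_mat (2*n) (2*n)"
    and K: "K \<in> carrier_mat (2*n) (2*n)"
    and herm: "hermitian_mat L"
    and skew: "skew_hermitian_mat J" and inv: "invertible_mat J"
    and Kdef: "K * (\<i> \<cdot>\<^sub>m J) = 1\<^sub>m (2*n)"
    and br: "eigen_branches L K (2*n) \<mu>"
  defines "n_u \<equiv> real (alg_mult_in (J * L) {\<nu>. Re \<nu> \<noteq> 0}) / 2"
    and "S \<equiv> (\<Sum>x\<in>{x\<in>real_char_values L K. x > 0}. krein_index 1 (2*n) \<mu> x)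
           + (\<Sum>x\<in>{x\<in>real_char_values L K. x < 0}. krein_index (-1) (2*n) \<mu> x)"
  shows "(n_u = real (neg_count L)
             - (real (gker_dim (J * L)) / 2
                - real (Z_down_plus (2*n) \<mu> + Z_down_minus (2*n) \<mu>) / 2)
             - S) \<and>
        (n_u = real (neg_count L)
             - ((real (gker_dim (J * L)) - 2 * real (kernel_dim L)) / 2
                + real (Z_up_plus (2*n) \<mu> + Z_up_minus (2*n) \<mu>) / 2)
             - S)"
proof -
  let ?N = "2 * n"
  have an: "real_analytic (\<mu> j)" if "j < ?N" for j using br that by (simp add: eigen_branches_def)
  let ?f = "\<lambda>x. - \<i> * complex_of_real x"
  define q where "q = char_poly (J * L)"
  define C where "C = \<i> ^ ?N * det (\<i> \<cdot>\<^sub>m J)"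
  have iJ: "\<i> \<cdot>\<^sub>m J \<in> carrier_mat ?N ?N" using J by simp
  have JL: "J * L \<in> carrier_mat ?N ?N" using J L by simp
  have "det K * det (\<i> \<cdot>\<^sub>m J) = 1"
    using det_mult[OF K iJ] Kdef by simp
  then have detK: "det K \<noteq> 0" and C: "C \<noteq> 0" by (auto simp: C_def simp del: det_smult)
  have q: "poly q (?f t) = C * complex_of_real (\<Prod>j<?N. \<mu> j t)" for t
    unfolding q_def C_def char_poly_imag_axis[OF L J K Kdef] det_pencil_eq_prod[OF L K br] ..
  have "q \<noteq> 0" using degree_monic_char_poly[OF JL] by (auto simp: q_def)
  define R where "R = real_char_values L K"
  have R: "x \<in> R \<longleftrightarrow> poly q (?f x) = 0" for x
    unfolding R_def real_char_values_def q using det_pencil_eq_prod[OF L K br] C by simp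
  have finR: "finite R"
  proof -
    have "R = ?f -` {z. poly q z = 0}" using R by auto
    then show ?thesis
      using finite_vimageI[OF poly_roots_finite[OF \<open>q \<noteq> 0\<close>], of ?f] by (simp add: inj_on_def)
  qed
  have Rnz: "\<mu> j x \<noteq> 0" if "x \<notin> R" "j < ?N" for x j
    using that unfolding R q by auto
  have nz: "\<exists>\<^sub>F y in at x. \<mu> j y \<noteq> 0" if "j < ?N" for x j
  proof (rule eventually_frequently)
    show "\<forall>\<^sub>F y in at x. \<mu> j y \<noteq> 0"
      using eventually_notin_finite[OF finR] by eventually_elim (rule Rnz[OF _ that])
  qed simp
  define P where "P = {x\<in>R. x > 0}"
  define M where "M = {x\<in>R. x < 0}"
  define k where "k = krein_index 1 ?N \<mu>"
  define k' where "k' = krein_index (-1) ?N \<mu>"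
  have S: "S = sum k P + sum k' M" by (simp add: S_def P_def M_def R_def k_def k'_def)

  have mult: "real (alg_mult (J * L) (?f x)) = k x + k' x" for x
  proof -
    have "alg_mult (J * L) (?f x) = (\<Sum>j<?N. vanish_order (\<mu> j) x)"
      unfolding alg_mult_def q_def[symmetric]
      by (rule order_eq_sum_vanish_order[OF an nz q \<open>q \<noteq> 0\<close> C])
    then show ?thesis
      by (simp add: k_def k'_def krein_index_eq_sum krein_branch_add flip: sum.distrib)
  qed
  \<comment> \<open>The value 0 is set apart because its multiplicity is already
    \<open>gker_dim (J * L)\<close>.\<close>
  have "R - {0} = P \<union> M" "P \<inter> M = {}" "finite P" "finite M"
    using finR by (auto simp: P_def M_def)
  then have "(\<Sum>x\<in>R - {0}. real (alg_mult (J * L) (?f x))) = sum k P + sum k' P + sum k M + sum k' M"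
    unfolding mult by (simp add: sum.union_disjoint sum.distrib)
  then have total: "real ?N = 2 * n_u + real (gker_dim (J * L)) + (sum k P + sum k' P + sum k M + sum k' M)"
    using total_multiplicity[OF JL R[unfolded q_def]] by (simp add: n_u_def gker_dim_def)

  \<comment> \<open>The factor 2 appears because a sign moves by 2 when a branch crosses
    zero.\<close>
  have jump: "(\<Sum>j<?N. \<Sum>x\<in>X. sgn_right (\<mu> j) x - sgn_left (\<mu> j) x) = 2 * (sum k X - sum k' X)" for X
    unfolding k_def k'_def krein_index_eq_sum
    by (subst sum.swap) (simp add: sum_distrib_left right_diff_distrib flip: krein_branch_diff sum_subtractf)
  have jumps: "(\<Sum>j<?N. sgn_right (\<mu> j) 0) + (\<Sum>j<?N. sgn_left (\<mu> j) 0)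
      = 2 * (sum k M - sum k' M) - 2 * (sum k P - sum k' P)"
    using sum_sgn_at_0_eq_jumps[OF L K br detK finR Rnz] unfolding P_def M_def jump .

  have "pencil L K (complex_of_real 0) = L"
    using L K by (intro eq_matI) (auto simp: pencil_def)
  then have cpL: "char_poly L = (\<Prod>j<?N. [:- complex_of_real (\<mu> j 0), 1:])"
    using br unfolding eigen_branches_def by metis
  have negL: "neg_count L = card {j. j < ?N \<and> \<mu> j 0 < 0}"
    unfolding neg_count_def alg_mult_in_eq_card[OF cpL] by simp
  have kerL: "kernel_dim L = card {j. j < ?N \<and> \<mu> j 0 = 0}"
    unfolding hermitian_kernel_dim[OF L herm] alg_mult_def cpL order_prod_linear by simp

  note side = sgn_at_side[OF an nz, folded sgn_right_def, folded sgn_left_def]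
  have sgn_nz: "sgn_right (\<mu> j) 0 \<noteq> 0" "sgn_left (\<mu> j) 0 \<noteq> 0" if "j < ?N" for j
    using vanish_order_limit(1)[OF an[OF that] nz[OF that]]
    by (simp_all add: sgn_left_def sgn_right_def sgn_zero_iff)
  have sgn_0: "sgn (\<mu> j 0) = sgn_right (\<mu> j) 0" "sgn (\<mu> j 0) = sgn_left (\<mu> j) 0"
    if "\<mu> j 0 \<noteq> 0" for j
    using vanish_order_eq_0[of "\<mu> j" 0] that by (simp_all add: sgn_left_def sgn_right_def)
  have plus: "(\<Sum>j<?N. sgn_right (\<mu> j) 0) = real ?N - 2 * (real (neg_count L) + real (Z_down_plus ?N \<mu>))"
    "Z_down_plus ?N \<mu> + Z_up_plus ?N \<mu> = kernel_dim L"
    using branch_counts_at_0[where \<mu> = \<mu> and N = "?N" and F = "at_right 0" and g = "\<lambda>j. sgn_right (\<mu> j) 0",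
        OF side(1) _ sgn_nz(1) sgn_0(1)]
    unfolding Z_down_plus_def Z_up_plus_def negL kerL by simp_all
  have minus: "(\<Sum>j<?N. sgn_left (\<mu> j) 0) = real ?N - 2 * (real (neg_count L) + real (Z_down_minus ?N \<mu>))"
    "Z_down_minus ?N \<mu> + Z_up_minus ?N \<mu> = kernel_dim L"
    using branch_counts_at_0[where \<mu> = \<mu> and N = "?N" and F = "at_left 0" and g = "\<lambda>j. sgn_left (\<mu> j) 0",
        OF side(2) _ sgn_nz(2) sgn_0(2)]
    unfolding Z_down_minus_def Z_up_minus_def negL kerL by simp_all
  \<comment> \<open>After inserting \<open>plus\<close> and \<open>minus\<close>, half of
    \<open>jumps\<close> is subtracted from \<open>total\<close>. The dimension cancels, and so do
    \<open>sum k' P\<close> and \<open>sum k M\<close>, while \<open>sum k P\<close> and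
    \<open>sum k' M\<close> double. This is why \<open>S\<close> uses one index on each
    half-line.\<close>
  have first: "n_u = real (neg_count L)
      - (real (gker_dim (J * L)) / 2 - real (Z_down_plus ?N \<mu> + Z_down_minus ?N \<mu>) / 2) - S"
    using total jumps plus(1) minus(1) unfolding S by (simp add: field_simps)
  have "real (Z_down_plus ?N \<mu> + Z_down_minus ?N \<mu>)
      = 2 * real (kernel_dim L) - real (Z_up_plus ?N \<mu> + Z_up_minus ?N \<mu>)"
    using plus(2) minus(2) by linarith
  with first show ?thesis by (simp add: field_simps)
qed

end
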